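(* There do not exist more than $24$ complete folding curves in $\mathbb{R}^2$ which are pairwise disjoint, i.e. such that no unit lattice edge is the support of segments of two different curves among them.
   Context: All sequences take values in $\{+1,-1\}$. For $S=(a_1,\dots,a_n)$ write $\overline{S}=(-a_n,\dots,-a_1)$. The $n$-folding sequences are defined recursively: the only $0$-folding sequence is the empty sequence, and the $(n+1)$-folding sequences are exactly $(\overline{S},+1,S)$ and $(\overline{S},-1,S)$ with $S$ an $n$-folding sequence. A subword of a sequence $(b_k)$ is a block $(b_{h+1},\dots,b_{h+m})$. A complete folding sequence is a sequence $(a_k)_{k\in\mathbb{Z}}$ each finite subword of which is a subword of some $n$-folding sequence. A segment is an oriented unit edge of $\mathbb{Z}^2$. A complete curve is a sequence $(C_i)_{i\in\mathbb{Z}}$ of segments such that the terminal point of $C_i$ is the initial point of $C_{i+1}$, consecutive supports are perpendicular, and all supports are pairwise distinct (curves differing by an index shift are identified). Its associated sequence is $(\eta_i)_{i\in\mathbb{Z}}$ with $\eta_i=+1$ (resp. $-1$) if one turns left (resp. right) from $C_i$ to $C_{i+1}$. A complete folding curve is a complete curve whose associated sequence is a complete folding sequence. *)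

theory Defs
  imports Main "HOL-Library.Sublist"
begin

definition bar :: "int list \<Rightarrow> int list" where
  "bar S = rev (map uminus S)"

fun folding_seqs :: "nat \<Rightarrow> int list set" where
  "folding_seqs 0 = {[]}"
| "folding_seqs (Suc n) = (\<Union>S\<in>folding_seqs n. {bar S @ [1] @ S, bar S @ [-1] @ S})"

text \<open>Taking \<open>m = 1\<close> below shows that such a sequence takes its values in \<open>{1, -1}\<close>.\<close>

definition complete_folding_seq :: "(int \<Rightarrow> int) \<Rightarrow> bool" where
  "complete_folding_seq a \<longleftrightarrow>
     (\<forall>h m. \<exists>n. \<exists>S\<in>folding_seqs n. sublist (map (\<lambda>k. a (h + int k)) [1..<Suc m]) S)"

text \<open>An oriented edge is the pair of its initial and terminal points; its support is
  represented by the unordered pair of its endpoints.\<close>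

type_synonym point = "int \<times> int"
type_synonym edge = "point \<times> point"

definition dir_x :: "edge \<Rightarrow> int" where
  "dir_x e = fst (snd e) - fst (fst e)"

definition dir_y :: "edge \<Rightarrow> int" where
  "dir_y e = snd (snd e) - snd (fst e)"

definition is_segment :: "edge \<Rightarrow> bool" where
  "is_segment e \<longleftrightarrow> \<bar>dir_x e\<bar> + \<bar>dir_y e\<bar> = 1"

definition support :: "edge \<Rightarrow> point set" where
  "support e = {fst e, snd e}"

definition perpendicular :: "edge \<Rightarrow> edge \<Rightarrow> bool" where
  "perpendicular e f \<longleftrightarrow> dir_x e * dir_x f + dir_y e * dir_y f = 0"

definition complete_curve :: "(int \<Rightarrow> edge) \<Rightarrow> bool" where
  "complete_curve C \<longleftrightarrow>
     (\<forall>i. is_segment (C i)) \<and>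
     (\<forall>i. snd (C i) = fst (C (i + 1))) \<and>
     (\<forall>i. perpendicular (C i) (C (i + 1))) \<and>
     (\<forall>i j. i \<noteq> j \<longrightarrow> support (C i) \<noteq> support (C j))"

text \<open>A left turn is a positive determinant of the two direction vectors. For perpendicular
  segments the determinant is nonzero, so the remaining case is a right turn.\<close>

definition turns_left :: "edge \<Rightarrow> edge \<Rightarrow> bool" where
  "turns_left e f \<longleftrightarrow> dir_x e * dir_y f - dir_y e * dir_x f > 0"

definition assoc_seq :: "(int \<Rightarrow> edge) \<Rightarrow> int \<Rightarrow> int" where
  "assoc_seq C i = (if turns_left (C i) (C (i + 1)) then 1 else -1)"

text \<open>Curves differing by an index shift are identified, so a complete folding curve is a
  class of parametrizations modulo \<open>shift_rel\<close>.\<close>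

definition shift_rel :: "((int \<Rightarrow> edge) \<times> (int \<Rightarrow> edge)) set" where
  "shift_rel = {(C, D). \<exists>k. \<forall>i. D i = C (i + k)}"

lemma equiv_shift_rel: "equiv UNIV shift_rel"
proof (rule equivI)
  show "refl shift_rel"
    by (auto simp: refl_on_def shift_rel_def intro: exI[of _ 0])
  show "sym shift_rel"
  proof (rule symI)
    fix C D assume "(C, D) \<in> shift_rel"
    then obtain k where "\<forall>i. D i = C (i + k)" by (auto simp: shift_rel_def)
    then have "\<forall>i. C i = D (i + - k)" by simp
    then show "(D, C) \<in> shift_rel" unfolding shift_rel_def by blast
  qed
  show "trans shift_rel"
  proof (rule transI)
    fix C D E assume "(C, D) \<in> shift_rel" "(D, E) \<in> shift_rel"
    then obtain k l where "\<forall>i. D i = C (i + k)" "\<forall>i. E i = D (i + l)"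
      unfolding shift_rel_def by blast
    then have "\<forall>i. E i = C (i + (l + k))" by (simp add: add.assoc)
    then show "(C, E) \<in> shift_rel" unfolding shift_rel_def by blast
  qed
qed simp

definition complete_folding_curves :: "(int \<Rightarrow> edge) set set" where
  "complete_folding_curves =
     {C. complete_curve C \<and> complete_folding_seq (assoc_seq C)} // shift_rel"

definition supports :: "(int \<Rightarrow> edge) set \<Rightarrow> point set set" where
  "supports X = (\<Union>C\<in>X. range (\<lambda>i. support (C i)))"

definition disjoint_curves :: "(int \<Rightarrow> edge) set \<Rightarrow> (int \<Rightarrow> edge) set \<Rightarrow> bool" where
  "disjoint_curves X Y \<longleftrightarrow> supports X \<inter> supports Y = {}"

end

theory Submission
  imports Defs
begin

text \<open>In an \<open>n\<close>-folding sequence the entries at the odd multiples of \<open>2 ^ k\<close> alternate, so keeping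
  every \<open>2 ^ k\<close>-th vertex of a folding curve yields again a curve with right-angled turns. For
  \<open>4 ^ m\<close> the steps of that coarse curve are axis-parallel of length \<open>2 ^ m\<close>, and every vertex of
  the original curve is within sup-distance \<open>2 ^ m\<close> of an adjacent coarse vertex. Three consecutive
  coarse steps therefore account for \<open>3 * 4 ^ m\<close> edges within sup-distance \<open>3 * 2 ^ m\<close> of a vertex
  of the middle one. As a square of half side \<open>3 * 2 ^ m + r\<close> contains \<open>72 * 4 ^ m + O(2 ^ m)\<close> edges,
  at most \<open>72 / 3 = 24\<close> disjoint curves fit.\<close>

section \<open>Alternation in folding sequences\<close>

lemma length_folding_seqs: "S \<in> folding_seqs n \<Longrightarrow> length S = 2 ^ n - 1"
  by (induction n arbitrary: S) (auto simp: bar_def)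

text \<open>Positions count from 1 here, hence the index \<open>x - 1\<close>: the middle letter
  stands at \<open>N\<close> and the left half is the reflection of \<open>S\<close> at
  \<open>N\<close>.\<close>

lemma nth_bar_snoc_append:
  assumes "length S = N - 1" "0 < x" "x < 2 * N"
  shows "(bar S @ [t] @ S) ! (x - 1) =
    (if x < N then - S ! (N - x - 1) else if x = N then t else S ! (x - N - 1))"
  using assms by (auto simp: bar_def nth_append rev_nth nth_Cons')

text \<open>Induction on \<open>n\<close>: in \<open>bar T @ [t] @ T\<close> the right half is a
  translate of \<open>T\<close>, the left half a reflection with changed signs, and both respect the
  alternation. The two entries flanking the middle come from the same letter of \<open>T\<close>
  with opposite signs.\<close>

lemma folding_seqs_alternate:
  assumes "S \<in> folding_seqs n" "x mod 2 ^ Suc k = 2 ^ k" "x + 2 ^ Suc k < 2 ^ n"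
  shows "S ! (x + 2 ^ Suc k - 1) = - S ! (x - 1)"
  using assms
proof (induction n arbitrary: S x)
  case 0
  then show ?case by simp
next
  case (Suc n)
  define N :: nat where "N = 2 ^ n"
  define K :: nat where "K = 2 ^ k"
  have Kpos: "K > 0" by (simp add: K_def)
  obtain T t where T: "T \<in> folding_seqs n" "S = bar T @ [t] @ T"
    using Suc.prems(1) by auto
  have len: "length T = N - 1" using length_folding_seqs[OF T(1)] by (simp add: N_def)
  have xm: "x mod (2 * K) = K" and xlt: "x + 2 * K < 2 * N"
    using Suc.prems by (simp_all add: K_def N_def)
  have x0: "x > 0" using xm Kpos by (cases x) auto
  have IH: "T ! (y + 2 * K - 1) = - T ! (y - 1)" if "y mod (2 * K) = K" "y + 2 * K < N" for y
    using Suc.IH[OF T(1), of y] that by (simp add: K_def N_def)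
  \<comment> \<open>Otherwise no two positions \<open>2 * K\<close> apart fit. So
    \<open>2 * K\<close> divides \<open>N\<close>, and translating or reflecting at \<open>N\<close>
    keeps the residue \<open>K\<close> modulo \<open>2 * K\<close>.\<close>
  have "k < n"
  proof (rule ccontr)
    assume "\<not> k < n"
    then have "N \<le> K" unfolding N_def K_def by (intro power_increasing) auto
    then show False using xlt by simp
  qed
  then have dvd: "2 * K dvd N"
    unfolding N_def K_def by (metis Suc_leI le_imp_power_dvd power_Suc)
  then obtain M where M: "N = 2 * K * M" by auto
  obtain j where j: "x = 2 * K * j + K"
    using xm by (metis mult_div_mod_eq)
  have S: "S ! (z - 1) =
      (if z < N then - T ! (N - z - 1) else if z = N then t else T ! (z - N - 1))"
    if "0 < z" "z < 2 * N" for z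
    unfolding T(2) using nth_bar_snoc_append[OF len that] .
  have "S ! (x + 2 * K - 1) = - S ! (x - 1)"
  \<comment> \<open>The positions \<open>x\<close> and \<open>x + 2 * K\<close> lie both to the
    right of \<open>N\<close>, at distance \<open>K\<close> on either side of it, or both to its
    left.\<close>
  proof (cases M "Suc j" rule: linorder_cases)
    case less
    then have "M \<le> j" by simp
    then obtain i where i: "j = M + i" using le_Suc_ex by blast
    have x: "x = N + (2 * K * i + K)" unfolding j M i by (simp add: algebra_simps)
    have "T ! (2 * K * i + K + 2 * K - 1) = - T ! (2 * K * i + K - 1)"
      using IH[of "2 * K * i + K"] xlt Kpos by (simp add: x)
    moreover have "S ! (x - 1) = T ! (2 * K * i + K - 1)"
      using S[of x] x0 xlt Kpos by (simp add: x)
    moreover have "S ! (x + 2 * K - 1) = T ! (2 * K * i + K + 2 * K - 1)"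
      using S[of "x + 2 * K"] x0 xlt Kpos by (simp add: x add.assoc)
    ultimately show ?thesis by simp
  next
    case equal
    have N: "N = x + K" unfolding M equal j by simp
    have "S ! (x - 1) = - T ! (K - 1)"
      using S[of x] x0 xlt Kpos by (simp add: N)
    moreover have "S ! (x + 2 * K - 1) = T ! (K - 1)"
      using S[of "x + 2 * K"] x0 xlt Kpos by (simp add: N)
    ultimately show ?thesis by simp
  next
    case greater
    then obtain i where i: "M = Suc (Suc j) + i" using le_Suc_ex Suc_leI by blast
    have N: "N = x + 2 * K + (2 * K * i + K)" unfolding j M i by (simp add: algebra_simps)
    have "T ! (2 * K * i + K + 2 * K - 1) = - T ! (2 * K * i + K - 1)"
      using IH[of "2 * K * i + K"] Kpos x0 by (simp add: N)
    moreover have "S ! (x - 1) = - T ! (2 * K * i + K + 2 * K - 1)"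
      using S[of x] x0 xlt Kpos by (simp add: N add_ac)
    moreover have "S ! (x + 2 * K - 1) = - T ! (2 * K * i + K - 1)"
      using S[of "x + 2 * K"] x0 xlt Kpos by (simp add: N add_ac)
    ultimately show ?thesis by simp
  qed
  then show ?case by (simp add: K_def)
qed

text \<open>The window from \<open>lo\<close> to \<open>hi\<close> is a block of one finite folding
  sequence, and \<open>h\<close> translates its indices into positions there. So \<open>h\<close>
  depends on the window but serves all \<open>k\<close> at once.\<close>

lemma complete_folding_seq_alternate:
  assumes "complete_folding_seq a"
  shows "\<exists>h. \<forall>k x. x mod 2 ^ Suc k = 2 ^ k \<longrightarrow> lo + h \<le> x \<longrightarrow> x + 2 ^ Suc k \<le> hi + h \<longrightarrow>
    a (x + 2 ^ Suc k - h) = - a (x - h)"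
proof -
  define m where "m = nat (hi - lo + 1)"
  let ?w = "map (\<lambda>k. a (lo - 1 + int k)) [1..<Suc m]"
  obtain n S where S: "S \<in> folding_seqs n" "sublist ?w S"
    using assms unfolding complete_folding_seq_def by blast
  then obtain ps ss where S_eq: "S = ps @ ?w @ ss" by (auto simp: sublist_def)
  \<comment> \<open>Index \<open>lo\<close> follows the prefix \<open>ps\<close>, so its position,
    counted from 1, is \<open>length ps + 1\<close>.\<close>
  define h where "h = int (length ps) + 1 - lo"
  have val: "S ! (nat z - 1) = a (z - h)" "nat z < 2 ^ n" "0 < z" if "lo + h \<le> z" "z \<le> hi + h" for z
  proof -
    define k where "k = nat (z - (lo + h))"
    have k: "k < m" "z = int (length ps + k + 1)"
      using that by (auto simp: k_def m_def h_def)
    have "nat z = length ps + k + 1" "z - h = lo + int k"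
      using k(2) by (simp_all add: h_def)
    then show "S ! (nat z - 1) = a (z - h)"
      using k(1) by (simp add: S_eq nth_append del: upt_Suc)
    have "length S = 2 ^ n - 1" using length_folding_seqs S(1) by blast
    moreover have "length ps + k + 1 \<le> length S" using k by (simp add: S_eq del: upt_Suc)
    moreover have "(0::nat) < 2 ^ n" by simp
    ultimately show "nat z < 2 ^ n" using k by linarith
    show "0 < z" using k by simp
  qed
  have "a (x + 2 ^ Suc k - h) = - a (x - h)"
    if x: "x mod 2 ^ Suc k = 2 ^ k" "lo + h \<le> x" "x + 2 ^ Suc k \<le> hi + h" for k x
  proof -
    define y where "y = x + 2 ^ Suc k"
    have "x \<le> y" "y \<le> hi + h" using x(3) by (simp_all add: y_def)
    then have xb: "x \<le> hi + h" and yb: "lo + h \<le> y" "y \<le> hi + h" using x(2) by linarith+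
    have x0: "0 < x" using val(3)[OF x(2) xb] .
    then have ny: "nat y = nat x + 2 ^ Suc k" by (simp add: y_def nat_add_distrib nat_mult_distrib nat_power_eq)
    have "int (nat x mod 2 ^ Suc k) = int (2 ^ k)"
      using x(1) x0 by (simp add: zmod_int)
    then have "nat x mod 2 ^ Suc k = 2 ^ k" by (simp only: of_nat_eq_iff)
    moreover have "nat x + 2 ^ Suc k < 2 ^ n" using val(2)[OF yb] by (simp only: ny)
    ultimately have "S ! (nat y - 1) = - S ! (nat x - 1)"
      unfolding ny by (rule folding_seqs_alternate[OF S(1)])
    then show ?thesis unfolding val(1)[OF x(2) xb] val(1)[OF yb] by (simp only: y_def)
  qed
  then show ?thesis by blast
qed

section \<open>Coarse steps of a folded path\<close>

text \<open>\<open>(X x, Y x)\<close> is vertex \<open>x\<close> of a path and \<open>t x\<close>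
  the turn there: the step leaving \<open>x\<close> is the step entering it, rotated by a quarter
  turn with sign \<open>t x\<close>. Alternation is only required between \<open>lo\<close> and
  \<open>hi\<close>.\<close>

locale folded_path =
  fixes X Y t :: "int \<Rightarrow> int" and lo hi :: int
  assumes turn: "t x = 1 \<or> t x = -1"
    and X_turn: "X (x + 1) - X x = - t x * (Y x - Y (x - 1))"
    and Y_turn: "Y (x + 1) - Y x = t x * (X x - X (x - 1))"
    and unit: "\<bar>X (x + 1) - X x\<bar> + \<bar>Y (x + 1) - Y x\<bar> = 1"
    and alternate: "x mod 2 ^ Suc k = 2 ^ k \<Longrightarrow> lo \<le> x \<Longrightarrow> x + 2 ^ Suc k \<le> hi \<Longrightarrow>
      t (x + 2 ^ Suc k) = - t x"
begin

text \<open>With \<open>d = 2 ^ k\<close>, let v1, v2, v3, v4 be the steps over \<open>d\<close>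
  from \<open>x - 2 * d\<close> to \<open>x + 2 * d\<close>, and J the left quarter turn. Then v3 is
  \<open>t x\<close> J v2, and the opposite turns at \<open>x - d\<close> and \<open>x + d\<close>
  make v4 equal to \<open>t x\<close> J v1. Adding gives the claim for \<open>2 * d\<close>.\<close>

lemma coarse_turn:
  assumes "2 ^ k dvd x" "lo \<le> x - 2 ^ k" "x + 2 ^ k \<le> hi"
  shows "X (x + 2 ^ k) - X x = - t x * (Y x - Y (x - 2 ^ k)) \<and>
    Y (x + 2 ^ k) - Y x = t x * (X x - X (x - 2 ^ k))"
  using assms
proof (induction k arbitrary: x)
  case 0
  then show ?case using X_turn[of x] Y_turn[of x] by simp
next
  case (Suc k)
  define d :: int where "d = 2 ^ k"
  have d: "d > 0" by (simp add: d_def)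
  have b: "lo \<le> x - 2 * d" "x + 2 * d \<le> hi" "2 * d dvd x"
    using Suc.prems by (simp_all add: d_def)
  then obtain q where q: "x = 2 * d * q" by auto
  have dv: "d dvd x" "d dvd x - d" "d dvd x + d" using q by (auto simp: algebra_simps)
  note IH = Suc.IH[folded d_def]
  have 1: "X (x + d) - X x = - t x * (Y x - Y (x - d))" "Y (x + d) - Y x = t x * (X x - X (x - d))"
    using IH[of x] dv b d by auto
  have 2: "X x - X (x - d) = - t (x - d) * (Y (x - d) - Y (x - 2 * d))"
    "Y x - Y (x - d) = t (x - d) * (X (x - d) - X (x - 2 * d))"
    using IH[of "x - d"] dv b d by (auto simp: algebra_simps)
  have 3: "X (x + 2 * d) - X (x + d) = - t (x + d) * (Y (x + d) - Y x)"
    "Y (x + 2 * d) - Y (x + d) = t (x + d) * (X (x + d) - X x)"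
    using IH[of "x + d"] dv b d by (auto simp: algebra_simps)
  \<comment> \<open>The midpoints \<open>x - d\<close> and \<open>x + d\<close> are consecutive odd
    multiples of \<open>d\<close>, so their turns are opposite.\<close>
  have "x - d = d + 2 * d * (q - 1)" unfolding q by (simp add: algebra_simps)
  then have "(x - d) mod (2 * d) = d" using d by (simp add: mod_mult_self2)
  then have "t (x - d + 2 * d) = - t (x - d)"
    using alternate[of "x - d" k, unfolded power_Suc, folded d_def] b d by simp
  then have 4: "t (x + d) = - t (x - d)" by (simp add: algebra_simps)
  have "X (x + 2 * d) - X x = - t x * (Y x - Y (x - 2 * d)) \<and>
    Y (x + 2 * d) - Y x = t x * (X x - X (x - 2 * d))"
    using turn[of x] turn[of "x - d"] 1 2 3 4 by auto
  then show ?case by (simp add: d_def)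
qed

text \<open>Four steps over \<open>4 ^ m\<close> add up to (1 + sJ)(1 + tJ) times the first, where J
  is the quarter turn and s, t are signs. This factor is 2 or a quarter turn times 2, so the sum
  norm doubles.\<close>

lemma coarse_step:
  assumes "4 ^ m dvd x" "lo \<le> x" "x + 4 ^ m \<le> hi"
  shows "\<bar>X (x + 4 ^ m) - X x\<bar> + \<bar>Y (x + 4 ^ m) - Y x\<bar> = 2 ^ m"
  using assms
proof (induction m arbitrary: x)
  case 0
  then show ?case using unit by simp
next
  case (Suc m)
  define d :: int where "d = 4 ^ m"
  have d: "d > 0" by (simp add: d_def)
  have d2: "d = 2 ^ (2 * m)" by (simp add: d_def power_mult)
  have d2': "2 * d = 2 ^ Suc (2 * m)" by (simp add: d2)
  have b: "lo \<le> x" "x + 4 * d \<le> hi" "4 * d dvd x"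
    using Suc.prems by (simp_all add: d_def)
  then obtain q where q: "x = 4 * d * q" by auto
  have dv: "d dvd x" "d dvd x + d" "2 * d dvd x + 2 * d" using q by (auto simp: algebra_simps)
  have 0: "\<bar>X (x + d) - X x\<bar> + \<bar>Y (x + d) - Y x\<bar> = 2 ^ m"
    using Suc.IH[of x, folded d_def] dv b d by simp
  have 1: "X (x + 2 * d) - X (x + d) = - t (x + d) * (Y (x + d) - Y x)"
    "Y (x + 2 * d) - Y (x + d) = t (x + d) * (X (x + d) - X x)"
    using coarse_turn[of "2 * m" "x + d", folded d2] dv b d by (auto simp: algebra_simps)
  have 2: "X (x + 4 * d) - X (x + 2 * d) = - t (x + 2 * d) * (Y (x + 2 * d) - Y x)"
    "Y (x + 4 * d) - Y (x + 2 * d) = t (x + 2 * d) * (X (x + 2 * d) - X x)"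
    using coarse_turn[of "Suc (2 * m)" "x + 2 * d", folded d2'] dv b d by (auto simp: algebra_simps)
  have "\<bar>X (x + 4 * d) - X x\<bar> + \<bar>Y (x + 4 * d) - Y x\<bar> = 2 * 2 ^ m"
    using turn[of "x + d"] turn[of "x + 2 * d"] 0 1 2 by auto
  then show ?case by (simp add: d_def)
qed

text \<open>Two consecutive coarse steps are (a, b) and a quarter turn of it, so each coordinate of
  their sum is at most |a| + |b| = \<open>2 ^ m\<close>. In sup-distance two steps cost no more than
  one.\<close>

lemma coarse_close:
  assumes "4 ^ m dvd x" "lo \<le> x" "x \<le> y" "y \<le> hi" "y = x \<or> y = x + 4 ^ m \<or> y = x + 2 * 4 ^ m"
  shows "\<bar>X y - X x\<bar> \<le> 2 ^ m \<and> \<bar>Y y - Y x\<bar> \<le> 2 ^ m"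
proof -
  define d :: int where "d = 4 ^ m"
  have d: "d > 0" by (simp add: d_def)
  have d2: "d = 2 ^ (2 * m)" by (simp add: d_def power_mult)
  consider "y = x" | "y = x + d" | "y = x + 2 * d" using assms(5) by (auto simp: d_def)
  then show ?thesis
  proof cases
    case 1
    then show ?thesis by simp
  next
    case 2
    then show ?thesis using coarse_step[of m x, folded d_def] assms(1-4)[folded d_def] by auto
  next
    case 3
    have "\<bar>X (x + d) - X x\<bar> + \<bar>Y (x + d) - Y x\<bar> = 2 ^ m"
      using coarse_step[of m x, folded d_def] assms(1-4)[folded d_def] 3 d by auto
    moreover have "X (x + 2 * d) - X (x + d) = - t (x + d) * (Y (x + d) - Y x)"
      "Y (x + 2 * d) - Y (x + d) = t (x + d) * (X (x + d) - X x)"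
      using coarse_turn[of "2 * m" "x + d", folded d2] assms(1-4)[folded d_def] 3 d
      by (auto simp: algebra_simps)
    ultimately show ?thesis using turn[of "x + d"] 3 by auto
  qed
qed

text \<open>Passing to \<open>Suc m\<close>, each of the five finer vertices on a coarse step is at
  most two finer steps from one of its ends. The distance grows by \<open>2 ^ m\<close>, and
  \<open>2 ^ m + 2 ^ m = 2 ^ Suc m\<close>.\<close>

lemma near_coarse_vertex:
  assumes "lo \<le> 4 ^ m * w" "4 ^ m * (w + 1) \<le> hi" "4 ^ m * w \<le> x" "x \<le> 4 ^ m * (w + 1)"
  shows "\<exists>v\<in>{w, w + 1}. \<bar>X x - X (4 ^ m * v)\<bar> \<le> 2 ^ m \<and> \<bar>Y x - Y (4 ^ m * v)\<bar> \<le> 2 ^ m"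
  using assms
proof (induction m arbitrary: w)
  case 0
  then have "x = w \<or> x = w + 1" by auto
  then show ?case by auto
next
  case (Suc m)
  define d :: int where "d = 4 ^ m"
  have d: "d > 0" by (simp add: d_def)
  have b: "lo \<le> d * (4 * w)" "d * (4 * w + 4) \<le> hi" "d * (4 * w) \<le> x" "x \<le> d * (4 * w + 4)"
    using Suc.prems by (simp_all add: d_def algebra_simps)
  have *: "d * i \<le> d * j \<longleftrightarrow> i \<le> j" for i j using d by simp
  \<comment> \<open>The cap \<open>4 * w + 3\<close> matters when \<open>x\<close> is the right end,
    whose quotient would name the next piece.\<close>
  define w' where "w' = min (x div d) (4 * w + 3)"
  have div: "d * (x div d) \<le> x" "x < d * (x div d) + d"
    using d pos_mod_sign[of d x] pos_mod_bound[of d x] mult_div_mod_eq[of d x] by linarith+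
  have "4 * w \<le> x div d"
    using zdiv_mono1[OF b(3) d] d by simp
  then have w': "4 * w \<le> w'" "w' \<le> 4 * w + 3" by (simp_all add: w'_def)
  have "d * w' \<le> d * (x div d)" using d by (simp add: w'_def)
  then have lower: "d * w' \<le> x" using div(1) by linarith
  have upper: "x \<le> d * (w' + 1)"
  proof (cases "x div d \<le> 4 * w + 3")
    case True
    then show ?thesis using div(2) by (simp add: w'_def distrib_left)
  next
    case False
    then have "w' + 1 = 4 * w + 4" by (simp add: w'_def)
    then show ?thesis using b(4) by (simp only:)
  qed
  have "lo \<le> d * w'" "d * (w' + 1) \<le> hi"
    using b w' *[of "4 * w" w'] *[of "w' + 1" "4 * w + 4"] by linarith+
  then obtain v where v: "v \<in> {w', w' + 1}" "\<bar>X x - X (d * v)\<bar> \<le> 2 ^ m" "\<bar>Y x - Y (d * v)\<bar> \<le> 2 ^ m"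
    using Suc.IH[of w', folded d_def] lower upper by blast
  then have "4 * w \<le> v" "v \<le> 4 * w + 4" using w' by auto
  then consider "v = 4 * w" | "v = 4 * w + 1" | "v = 4 * w + 2" | "v = 4 * w + 3" | "v = 4 * w + 4"
    by linarith
  then have "\<exists>u\<in>{w, w + 1}. \<bar>X (d * v) - X (4 * d * u)\<bar> \<le> 2 ^ m \<and> \<bar>Y (d * v) - Y (4 * d * u)\<bar> \<le> 2 ^ m"
  proof cases
    case 4
    then show ?thesis
      using coarse_close[of m "d * v" "d * (4 * w + 4)"] b d
      by (auto simp: d_def[symmetric] algebra_simps abs_minus_commute)
  qed (use coarse_close[of m "d * (4 * w)" "d * v"] b d in
      \<open>auto simp: d_def[symmetric] algebra_simps\<close>)
  then obtain u where "u \<in> {w, w + 1}" "\<bar>X (d * v) - X (4 * d * u)\<bar> \<le> 2 ^ m"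
    "\<bar>Y (d * v) - Y (4 * d * u)\<bar> \<le> 2 ^ m" by blast
  then show ?case using v(2,3) by (intro bexI[of _ u]) (auto simp: d_def)
qed

text \<open>Go from \<open>x\<close> to a nearby coarse vertex, then to one near \<open>y\<close>,
  then to \<open>y\<close>. As \<open>x\<close> lies on the middle step, the two coarse vertices are
  at most two steps apart, so each leg costs at most \<open>2 ^ m\<close>.\<close>

lemma three_coarse_steps_close:
  assumes "lo \<le> 4 ^ m * (w - 1)" "4 ^ m * (w + 2) \<le> hi"
    and "4 ^ m * w \<le> x" "x \<le> 4 ^ m * (w + 1)"
    and "4 ^ m * (w - 1) \<le> y" "y \<le> 4 ^ m * (w + 2)"
  shows "\<bar>X y - X x\<bar> \<le> 3 * 2 ^ m \<and> \<bar>Y y - Y x\<bar> \<le> 3 * 2 ^ m"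
proof -
  define d :: int where "d = 4 ^ m"
  have d: "d > 0" by (simp add: d_def)
  note a = assms[folded d_def]
  have exp: "d * (w - 1) = d * w - d" "d * (w + 1) = d * w + d" "d * (w + 2) = d * w + 2 * d"
    by (simp_all add: algebra_simps)
  have "lo \<le> d * w" "d * (w + 1) \<le> hi" using a d by (simp_all add: exp)
  then obtain v where v: "v \<in> {w, w + 1}" "\<bar>X x - X (d * v)\<bar> \<le> 2 ^ m" "\<bar>Y x - Y (d * v)\<bar> \<le> 2 ^ m"
    using near_coarse_vertex[of m w x, folded d_def] a by blast
  obtain w' where w': "w' \<in> {w - 1, w, w + 1}" "d * w' \<le> y" "y \<le> d * (w' + 1)"
  proof -
    consider "y \<le> d * w" | "d * w \<le> y" "y \<le> d * (w + 1)" | "d * (w + 1) \<le> y" by linarith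
    then show ?thesis
      by cases (use that[of "w - 1"] that[of w] that[of "w + 1"] a in \<open>auto simp: add.commute\<close>)
  qed
  have "d * (w - 1) \<le> d * w'" "d * (w' + 1) \<le> d * (w + 2)" using w'(1) d by auto
  then have "lo \<le> d * w'" "d * (w' + 1) \<le> hi" using a by linarith+
  then obtain u where "u \<in> {w', w' + 1}"
    and u': "\<bar>X y - X (d * u)\<bar> \<le> 2 ^ m" "\<bar>Y y - Y (d * u)\<bar> \<le> 2 ^ m"
    using near_coarse_vertex[of m w' y, folded d_def] w' by blast
  then have u: "u \<in> {w - 1, w, w + 1, w + 2}" using w'(1) by auto
  have close: "\<bar>X (d * j) - X (d * i)\<bar> \<le> 2 ^ m \<and> \<bar>Y (d * j) - Y (d * i)\<bar> \<le> 2 ^ m"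
    if "w - 1 \<le> i" "i \<le> j" "j \<le> i + 2" "j \<le> w + 2" for i j
  proof -
    have "d * (w - 1) \<le> d * i" "d * i \<le> d * j" "d * j \<le> d * (w + 2)"
      using that d by simp_all
    moreover have "j = i \<or> j = i + 1 \<or> j = i + 2" using that by linarith
    then have "d * j = d * i \<or> d * j = d * i + d \<or> d * j = d * i + 2 * d"
      by (auto simp: algebra_simps)
    ultimately show ?thesis
      using coarse_close[of m "d * i" "d * j", folded d_def] a by simp
  qed
  have "\<bar>X (d * u) - X (d * v)\<bar> \<le> 2 ^ m \<and> \<bar>Y (d * u) - Y (d * v)\<bar> \<le> 2 ^ m"
  proof (cases "u \<le> v")
    case True
    then show ?thesis using close[of u v] u v(1) by (auto simp: abs_minus_commute)
  next
    case False
    then show ?thesis using close[of v u] u v(1) by auto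
  qed
  then show ?thesis using u' v by linarith
qed

end

section \<open>Counting edges\<close>

lemma perpendicular_turn:
  assumes "is_segment e" "is_segment f" "perpendicular e f"
  defines "s \<equiv> if turns_left e f then 1 else -1"
  shows "dir_x f = - s * dir_y e" "dir_y f = s * dir_x e"
proof -
  have "(dir_x e, dir_y e) \<in> {(1, 0), (-1, 0), (0, 1), (0, -1)}"
    "(dir_x f, dir_y f) \<in> {(1, 0), (-1, 0), (0, 1), (0, -1)}"
    using assms(1,2) unfolding is_segment_def by (auto; arith)+
  then show "dir_x f = - s * dir_y e" "dir_y f = s * dir_x e"
    using assms(3) by (auto simp: s_def perpendicular_def turns_left_def)
qed

definition box :: "int \<Rightarrow> point set" where
  "box r = {-r..r} \<times> {-r..r}"

text \<open>The edges are those of three consecutive coarse steps, the middle one containing the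
  start of \<open>C 0\<close>.\<close>

lemma complete_folding_curve_edges_in_box:
  assumes "complete_curve C" "complete_folding_seq (assoc_seq C)" "fst (C 0) \<in> box r"
  shows "\<exists>l. \<forall>i\<in>{l..<l + 3 * 4 ^ m}. support (C i) \<subseteq> box (3 * 2 ^ m + r)"
proof -
  define d :: int where "d = 4 ^ m"
  have d: "d > 0" by (simp add: d_def)
  obtain h where h: "assoc_seq C (x + 2 ^ Suc k - h) = - assoc_seq C (x - h)"
    if "x mod 2 ^ Suc k = 2 ^ k" "- 3 * d + h \<le> x" "x + 2 ^ Suc k \<le> 3 * d + h" for k x
    using complete_folding_seq_alternate[OF assms(2), of "- 3 * d" "3 * d"] by blast
  \<comment> \<open>Vertex \<open>x\<close> is the initial point of \<open>C (x - g)\<close>, and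
    the turn there is the one from \<open>C (x - h)\<close> to \<open>C (x - h + 1)\<close>; hence
    the shift by one.\<close>
  define g where "g = h - 1"
  define X where "X x = fst (fst (C (x - g)))" for x
  define Y where "Y x = snd (fst (C (x - g)))" for x
  define t where "t x = assoc_seq C (x - h)" for x
  have seg: "is_segment (C i)" and link: "snd (C i) = fst (C (i + 1))"
    and perp: "perpendicular (C i) (C (i + 1))" for i
    using assms(1) by (auto simp: complete_curve_def)
  have dir: "X (x + 1) - X x = dir_x (C (x - g))" "Y (x + 1) - Y x = dir_y (C (x - g))" for x
    using link[of "x - g"] by (simp_all add: X_def Y_def dir_x_def dir_y_def algebra_simps)
  interpret folded_path X Y t "- 3 * d + h" "3 * d + h"
  proof
    fix x :: int and k :: nat
    have shift: "x - g = x - h + 1" by (simp add: g_def)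
    have prev: "X x - X (x - 1) = dir_x (C (x - h))" "Y x - Y (x - 1) = dir_y (C (x - h))"
      using dir[of "x - 1"] by (simp_all add: g_def)
    show "t x = 1 \<or> t x = -1" by (simp add: t_def assoc_seq_def)
    show "X (x + 1) - X x = - t x * (Y x - Y (x - 1))" "Y (x + 1) - Y x = t x * (X x - X (x - 1))"
      unfolding dir prev shift t_def assoc_seq_def
      by (rule perpendicular_turn[OF seg seg perp])+
    show "\<bar>X (x + 1) - X x\<bar> + \<bar>Y (x + 1) - Y x\<bar> = 1"
      unfolding dir using seg by (simp add: is_segment_def)
    show "t (x + 2 ^ Suc k) = - t x" if "x mod 2 ^ Suc k = 2 ^ k" "- 3 * d + h \<le> x"
      "x + 2 ^ Suc k \<le> 3 * d + h"
      unfolding t_def using h that by blast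
  qed
  define w where "w = g div d"
  have w: "d * w \<le> g" "g < d * w + d"
    using d pos_mod_sign[of d g] pos_mod_bound[of d g] mult_div_mod_eq[of d g]
    unfolding w_def by linarith+
  define l where "l = d * w - d - g"
  \<comment> \<open>The upper bound is inclusive because the last edge also contributes its terminal
    point.\<close>
  have vertex: "fst (C i) \<in> box (3 * 2 ^ m + r)" if "l \<le> i" "i \<le> l + 3 * d" for i
  proof -
    have "\<bar>X (i + g) - X g\<bar> \<le> 3 * 2 ^ m \<and> \<bar>Y (i + g) - Y g\<bar> \<le> 3 * 2 ^ m"
      using that w by (intro three_coarse_steps_close[of m w, folded d_def])
        (simp_all add: l_def g_def algebra_simps)
    then show ?thesis using assms(3)
      by (auto simp: X_def Y_def box_def mem_Times_iff)
  qed
  have "support (C i) \<subseteq> box (3 * 2 ^ m + r)" if "i \<in> {l..<l + 3 * 4 ^ m}" for i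
    using that vertex[of i] vertex[of "i + 1"] by (simp add: support_def link d_def)
  then show ?thesis by blast
qed

text \<open>A support is determined by its left or lower endpoint and one of two directions.\<close>

lemma card_supports_in_box:
  assumes "A \<subseteq> support ` {e. is_segment e \<and> support e \<subseteq> box r}" "r \<ge> 0"
  shows "finite A \<and> int (card A) \<le> 2 * (2 * r + 1) ^ 2"
proof -
  define f :: "point \<times> point \<Rightarrow> point set"
    where "f = (\<lambda>(p, v). {p, (fst p + fst v, snd p + snd v)})"
  let ?D = "box r \<times> ({(1, 0), (0, 1)} :: point set)"
  have "A \<subseteq> f ` ?D"
  proof
    fix a assume "a \<in> A"
    then obtain e where e: "a = support e" "is_segment e" "support e \<subseteq> box r"
      using assms(1) by blast
    obtain x y x' y' where "e = ((x, y), (x', y'))" by (metis surj_pair)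
    with e have a: "a = {(x, y), (x', y')}" "\<bar>x' - x\<bar> + \<bar>y' - y\<bar> = 1"
      "(x, y) \<in> box r" "(x', y') \<in> box r"
      by (simp_all add: support_def is_segment_def dir_x_def dir_y_def)
    then consider "x' = x + 1" "y' = y" | "x' = x" "y' = y + 1"
      | "x = x' + 1" "y' = y" | "x' = x" "y = y' + 1" by arith
    then show "a \<in> f ` ?D"
    proof cases
      case 1
      then show ?thesis using a by (intro image_eqI[of _ _ "((x, y), (1, 0))"]) (auto simp: f_def)
    next
      case 2
      then show ?thesis using a by (intro image_eqI[of _ _ "((x, y), (0, 1))"]) (auto simp: f_def)
    next
      case 3
      then show ?thesis using a by (intro image_eqI[of _ _ "((x', y'), (1, 0))"]) (auto simp: f_def)
    next
      case 4
      then show ?thesis using a by (intro image_eqI[of _ _ "((x', y'), (0, 1))"]) (auto simp: f_def)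
    qed
  qed
  moreover have fin: "finite ?D" by (simp add: box_def)
  ultimately have "finite A" "card A \<le> card ?D"
    using finite_surj[of ?D A f] surj_card_le[of ?D A f] by simp_all
  moreover have "int (card ?D) = 2 * (2 * r + 1) ^ 2"
    using assms(2) by (simp add: box_def card_cartesian_product power2_eq_square)
  ultimately show ?thesis by linarith
qed

theorem theorem3p16:
  fixes \<C> :: "(int \<Rightarrow> edge) set set"
  assumes "\<C> \<subseteq> complete_folding_curves"
    and "pairwise disjoint_curves \<C>"
  shows "finite \<C> \<and> card \<C> \<le> 24"
proof (rule ccontr)
  assume neg: "\<not> (finite \<C> \<and> card \<C> \<le> 24)"
  \<comment> \<open>A finite subfamily of 25 curves has all its starting points in a common box, and
    refutes infinite families too.\<close>
  obtain F where F: "F \<subseteq> \<C>" "finite F" "card F = 25"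
  proof (cases "finite \<C>")
    case True
    then have "25 \<le> card \<C>" using neg by simp
    then show ?thesis using obtain_subset_with_card_n that by metis
  next
    case False
    then show ?thesis using infinite_arbitrarily_large that by metis
  qed
  have "\<exists>C\<in>K. complete_curve C \<and> complete_folding_seq (assoc_seq C)" if "K \<in> F" for K
  proof -
    have "K \<in> complete_folding_curves" using that F(1) assms(1) by blast
    then show ?thesis unfolding complete_folding_curves_def
      using equiv_class_self[OF equiv_shift_rel] by (fastforce elim: quotientE)
  qed
  then obtain f where f: "f K \<in> K" "complete_curve (f K)" "complete_folding_seq (assoc_seq (f K))"
    if "K \<in> F" for K by metis
  define r where "r = (\<Sum>K\<in>F. \<bar>fst (fst (f K 0))\<bar> + \<bar>snd (fst (f K 0))\<bar>)"
  have r0: "r \<ge> 0" by (auto simp: r_def intro: sum_nonneg)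
  have start: "fst (f K 0) \<in> box r" if "K \<in> F" for K
  proof -
    have "\<bar>fst (fst (f K 0))\<bar> + \<bar>snd (fst (f K 0))\<bar> \<le> r"
      unfolding r_def by (rule member_le_sum[OF that _ F(2)]) simp
    then show ?thesis by (auto simp: box_def mem_Times_iff)
  qed
  define q where "q = 2 * r + 1"
  \<comment> \<open>Chosen so that \<open>u = 2 ^ m\<close> exceeds \<open>9 * q\<close>; then
    \<open>24 * (u * q) + 2 * (q * q)\<close> is at most \<open>26 * (u * q)\<close>, which is below
    \<open>3 * (u * u)\<close>.\<close>
  define m where "m = nat (9 * q)"
  have "int m < int (2 ^ m)" using less_exp by (simp only: of_nat_less_iff)
  moreover have "q \<ge> 0" using r0 by (simp add: q_def)
  ultimately have m: "9 * q < 2 ^ m" by (simp add: m_def)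
  define u :: int where "u = 2 ^ m"
  have "\<forall>K\<in>F. \<exists>l. \<forall>i\<in>{l..<l + 3 * 4 ^ m}. support (f K i) \<subseteq> box (3 * u + r)"
    using complete_folding_curve_edges_in_box[OF f(2,3) start] unfolding u_def by blast
  then obtain l where l: "support (f K i) \<subseteq> box (3 * u + r)"
    if "K \<in> F" "i \<in> {l K..<l K + 3 * 4 ^ m}" for K i
    unfolding bchoice_iff by blast
  let ?I = "\<lambda>K. {l K..<l K + 3 * 4 ^ m}"
  define A where "A K = (\<lambda>i. support (f K i)) ` ?I K" for K
  have cardA: "card (A K) = 3 * 4 ^ m" if "K \<in> F" for K
  proof -
    have "inj_on (\<lambda>i. support (f K i)) (?I K)"
      using f(2)[OF that] by (auto simp: inj_on_def complete_curve_def)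
    then show ?thesis by (simp add: A_def card_image nat_mult_distrib nat_power_eq)
  qed
  have disj: "A K \<inter> A L = {}" if "K \<in> F" "L \<in> F" "K \<noteq> L" for K L
  proof -
    have "supports K \<inter> supports L = {}"
      using assms(2) F(1) that by (auto simp: pairwise_def disjoint_curves_def)
    moreover have "A K \<subseteq> supports K" "A L \<subseteq> supports L"
      using f(1) that by (auto simp: A_def supports_def)
    ultimately show ?thesis by blast
  qed
  have "card (\<Union>K\<in>F. A K) = (\<Sum>K\<in>F. card (A K))"
    using F(2) disj by (intro card_UN_disjoint) (auto simp: A_def)
  also have "\<dots> = 75 * 4 ^ m" using cardA F(3) by simp
  finally have "int (card (\<Union>K\<in>F. A K)) = 75 * u ^ 2"
    by (simp add: u_def power_mult[symmetric] mult.commute[of m] power_mult)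
  moreover have "(\<Union>K\<in>F. A K) \<subseteq> support ` {e. is_segment e \<and> support e \<subseteq> box (3 * u + r)}"
    using l f(2) by (fastforce simp: A_def complete_curve_def)
  ultimately have "75 * u ^ 2 \<le> 2 * (2 * (3 * u + r) + 1) ^ 2"
    using card_supports_in_box[of "\<Union>K\<in>F. A K" "3 * u + r"] r0 by (simp add: u_def)
  \<comment> \<open>The side \<open>2 * (3 * u + r) + 1\<close> equals \<open>6 * u + q\<close>. The
    leading coefficient 72 loses against the 75 = 25 * 3 of the edge count.\<close>
  also have "\<dots> = 72 * u ^ 2 + 24 * (u * q) + 2 * (q * q)"
    by (simp add: q_def power2_eq_square algebra_simps)
  finally have "3 * (u * u) \<le> 24 * (u * q) + 2 * (q * q)"
    by (simp add: power2_eq_square)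
  moreover have "q * q \<le> u * q" "9 * (u * q) < u * u"
    using m r0 by (auto simp: u_def[symmetric] q_def intro!: mult_right_mono)
  moreover have "u * q > 0" using m r0 by (simp add: u_def q_def)
  ultimately show False by linarith
qed

end
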